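(* Let $P$ be a finite poset with a least element $\hat 0$ and a greatest element $\hat 1$, $\hat 0 \neq \hat 1$. Let $P_{st}$ be the network whose vertex set is $P$, whose source is $s=\hat 0$, whose sink is $t=\hat 1$, whose set of directed edges is $E=\{(x,y)\in P\times P : y \text{ covers } x\}$, and in which every edge has capacity $1$. Then the maximum cardinality of a cover-disjoint set of maximal chains of $P$ is equal to the net flow of a maximum flow in $P_{st}$.
   Context: In a poset, $y$ covers $x$ if $x<y$ and there is no $z$ with $x<z<y$. A chain is a subset any two elements of which are comparable; a chain $C$ of $P$ is maximal if $C\cup\{x\}$ is not a chain for any $x\in P\setminus C$. A set of chains $\{C_i\}$ is cover-disjoint if, whenever $y$ covers $x$ in $P$, the pair $\{x,y\}$ is contained in at most one of the chains $C_i$. A flow on a network with vertex set $V$, directed edge set $E$, source $s$, sink $t$ and capacity function $c:E\to\mathbb{R}_{\ge 0}$ is a function $f:E\to\mathbb{R}_{\geq 0}$ such that $f(e)\le c(e)$ for every $e\in E$ and, for every vertex $v\ne s,t$, $\sum_{(v,x)\in E} f(v,x)=\sum_{(x,v)\in E} f(x,v)$. Its net flow is $|f|=\sum_{(s,x)\in E} f(s,x)-\sum_{(x,s)\in E} f(x,s)$. A maximum flow is a flow with maximum net flow among all flows on the network. *)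

theory Defs
  imports Complex_Main
begin

text \<open>
  A poset is a carrier \<open>P\<close> with a relation \<open>r\<close> such that \<^term>\<open>partial_order_on P r\<close>;
  the pair \<open>(x, y) \<in> r\<close> means \<open>x \<le> y\<close>, and \<open>r \<subseteq> P \<times> P\<close>. Thus \<open>z\<close> below and the elements of
  \<open>Chains r\<close> are confined to \<open>P\<close>.
\<close>

definition covers :: "'a rel \<Rightarrow> 'a \<Rightarrow> 'a \<Rightarrow> bool" where
  "covers r y x \<longleftrightarrow>
     (x, y) \<in> r \<and> x \<noteq> y \<and>
     \<not> (\<exists>z. (x, z) \<in> r \<and> x \<noteq> z \<and> (z, y) \<in> r \<and> z \<noteq> y)"

definition maximal_chain :: "'a set \<Rightarrow> 'a rel \<Rightarrow> 'a set \<Rightarrow> bool" where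
  "maximal_chain P r C \<longleftrightarrow>
     C \<subseteq> P \<and> C \<in> Chains r \<and> (\<forall>x\<in>P - C. insert x C \<notin> Chains r)"

definition cover_disjoint :: "'a rel \<Rightarrow> 'a set set \<Rightarrow> bool" where
  "cover_disjoint r S \<longleftrightarrow>
     (\<forall>x y. covers r y x \<longrightarrow> (\<forall>C\<in>S. \<forall>D\<in>S. {x, y} \<subseteq> C \<and> {x, y} \<subseteq> D \<longrightarrow> C = D))"

record 'v network =
  verts :: "'v set"
  edges :: "('v \<times> 'v) set"
  source :: 'v
  sink :: 'v
  capacity :: "'v \<times> 'v \<Rightarrow> real"

text \<open>
  Flows and capacities are total functions of which only the values on
  \<^term>\<open>edges N\<close> matter.
\<close>

definition flow :: "'v network \<Rightarrow> ('v \<times> 'v \<Rightarrow> real) \<Rightarrow> bool" where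
  "flow N f \<longleftrightarrow>
     (\<forall>e\<in>edges N. 0 \<le> f e \<and> f e \<le> capacity N e) \<and>
     (\<forall>v\<in>verts N - {source N, sink N}.
        (\<Sum>x | (v, x) \<in> edges N. f (v, x)) = (\<Sum>x | (x, v) \<in> edges N. f (x, v)))"

definition net_flow :: "'v network \<Rightarrow> ('v \<times> 'v \<Rightarrow> real) \<Rightarrow> real" where
  "net_flow N f =
     (\<Sum>x | (source N, x) \<in> edges N. f (source N, x)) -
     (\<Sum>x | (x, source N) \<in> edges N. f (x, source N))"

definition maximum_flow :: "'v network \<Rightarrow> ('v \<times> 'v \<Rightarrow> real) \<Rightarrow> bool" where
  "maximum_flow N f \<longleftrightarrow> flow N f \<and> (\<forall>g. flow N g \<longrightarrow> net_flow N g \<le> net_flow N f)"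

definition poset_network :: "'a set \<Rightarrow> 'a rel \<Rightarrow> 'a \<Rightarrow> 'a \<Rightarrow> 'a network" where
  "poset_network P r s t =
     \<lparr>verts = P, edges = {(x, y) \<in> P \<times> P. covers r y x}, source = s, sink = t,
      capacity = (\<lambda>_. 1)\<rparr>"

end

theory Submission
  imports Defs
begin

text \<open>
  A cover-disjoint family of maximal chains is the same thing as a family of edge-disjoint
  \<open>s\<close>-\<open>t\<close> paths in the Hasse diagram. Superposing the paths gives a flow whose value is the
  number of chains. Conversely, a 0/1-valued flow of largest value admits no augmenting path,
  so the vertices reachable in its residual graph form a cut that bounds every real flow;
  and peeling off one maximal chain at a time turns this 0/1-valued flow into as many
  cover-disjoint chains as its value.
\<close>

section \<open>Net outflow at a vertex\<close>

text \<open>Outflow minus inflow at \<open>v\<close>, written as one sum over the edges with signed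
  incidence coefficients. Linearity in \<open>g\<close> and exchange of summation over vertices and
  edges are then immediate. Conservation at \<open>v\<close> means that this is zero, and at the
  source it is the net flow.\<close>

definition excess :: "('v \<times> 'v) set \<Rightarrow> ('v \<times> 'v \<Rightarrow> real) \<Rightarrow> 'v \<Rightarrow> real" where
  "excess E g v = (\<Sum>e\<in>E. g e * (of_bool (fst e = v) - of_bool (snd e = v)))"

lemma excess_altdef:
  assumes "finite E"
  shows "excess E g v = (\<Sum>x | (v, x) \<in> E. g (v, x)) - (\<Sum>x | (x, v) \<in> E. g (x, v))"
proof -
  have "(\<Sum>e\<in>E. g e * of_bool (fst e = v)) = (\<Sum>e | e \<in> E \<and> fst e = v. g e)"
    using assms by (simp add: of_bool_def if_distrib sum.If_cases Int_def cong: if_cong)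
  also have "\<dots> = (\<Sum>x | (v, x) \<in> E. g (v, x))"
    by (rule sum.reindex_bij_witness[of _ "\<lambda>x. (v, x)" snd]) auto
  finally have out: "(\<Sum>e\<in>E. g e * of_bool (fst e = v)) = (\<Sum>x | (v, x) \<in> E. g (v, x))" .
  have "(\<Sum>e\<in>E. g e * of_bool (snd e = v)) = (\<Sum>e | e \<in> E \<and> snd e = v. g e)"
    using assms by (simp add: of_bool_def if_distrib sum.If_cases Int_def cong: if_cong)
  also have "\<dots> = (\<Sum>x | (x, v) \<in> E. g (x, v))"
    by (rule sum.reindex_bij_witness[of _ "\<lambda>x. (x, v)" fst]) auto
  finally show ?thesis
    using out by (simp add: excess_def right_diff_distrib sum_subtractf)
qed

lemma excess_cong: "(\<And>e. e \<in> E \<Longrightarrow> f e = g e) \<Longrightarrow> excess E f v = excess E g v"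
  by (simp add: excess_def)

lemma excess_add: "excess E (\<lambda>e. f e + g e) v = excess E f v + excess E g v"
  by (simp add: excess_def distrib_right sum.distrib)

lemma excess_diff: "excess E (\<lambda>e. f e - g e) v = excess E f v - excess E g v"
  by (simp add: excess_def left_diff_distrib sum_subtractf)

lemma excess_sum: "excess E (\<lambda>e. \<Sum>i\<in>I. f i e) v = (\<Sum>i\<in>I. excess E (f i) v)"
  unfolding excess_def sum_distrib_right by (rule sum.swap)

lemma excess_single:
  assumes "finite E" "e \<in> E"
  shows "excess E (\<lambda>x. of_bool (x = e)) v = of_bool (fst e = v) - of_bool (snd e = v)"
proof -
  have "excess E (\<lambda>x. of_bool (x = e)) v
      = (\<Sum>x\<in>E. if x = e then of_bool (fst e = v) - of_bool (snd e = v) else 0)"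
    unfolding excess_def by (rule sum.cong) auto
  then show ?thesis using assms by simp
qed

lemma excess_of_bool:
  assumes "finite E" "F \<subseteq> E"
  shows "excess E (\<lambda>e. of_bool (e \<in> F)) v
    = real (card {x. (v, x) \<in> F}) - real (card {x. (x, v) \<in> F})"
proof -
  have "finite {x. (v, x) \<in> E}"
    by (rule finite_subset[of _ "snd ` E"]) (use assms in force)+
  moreover have "finite {x. (x, v) \<in> E}"
    by (rule finite_subset[of _ "fst ` E"]) (use assms in force)+
  moreover have "{x. (v, x) \<in> E} \<inter> {x. (v, x) \<in> F} = {x. (v, x) \<in> F}"
    "{x. (x, v) \<in> E} \<inter> {x. (x, v) \<in> F} = {x. (x, v) \<in> F}"
    using assms by auto
  ultimately show ?thesis
    using assms by (simp add: excess_altdef sum_of_bool_eq)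
qed

text \<open>Edges with both ends in \<open>X\<close> or both outside cancel, so only the boundary of
  \<open>X\<close> contributes: this is the cut formula for the value of a flow.\<close>

lemma sum_excess:
  assumes "finite X"
  shows "(\<Sum>v\<in>X. excess E g v) = (\<Sum>e\<in>E. g e * (of_bool (fst e \<in> X) - of_bool (snd e \<in> X)))"
proof -
  have *: "(\<Sum>v\<in>X. of_bool (a = v)) = (of_bool (a \<in> X) :: real)" for a
    using assms by (simp add: of_bool_def)
  have "(\<Sum>v\<in>X. excess E g v)
      = (\<Sum>e\<in>E. \<Sum>v\<in>X. g e * (of_bool (fst e = v) - of_bool (snd e = v)))"
    unfolding excess_def by (rule sum.swap)
  also have "\<dots> = (\<Sum>e\<in>E. g e * (of_bool (fst e \<in> X) - of_bool (snd e \<in> X)))"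
    by (simp add: sum_distrib_left[symmetric] sum_subtractf *)
  finally show ?thesis .
qed

section \<open>Augmenting paths and the maximum flow for unit capacities\<close>

text \<open>
  \<open>residual_reach E F s v W\<close>: some path from \<open>s\<close> to \<open>v\<close> in the residual graph of \<open>F\<close> visits
  exactly the vertices \<open>W\<close>, each of them once. Remembering \<open>W\<close> ensures that earlier
  augmentation steps did not touch the edge used next.
\<close>

inductive residual_reach :: "('v \<times> 'v) set \<Rightarrow> ('v \<times> 'v) set \<Rightarrow> 'v \<Rightarrow> 'v \<Rightarrow> 'v set \<Rightarrow> bool"
  for E F s where
  start: "residual_reach E F s s {s}"
| forward: "residual_reach E F s u W \<Longrightarrow> v \<notin> W \<Longrightarrow> (u, v) \<in> E - F
    \<Longrightarrow> residual_reach E F s v (insert v W)"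
| backward: "residual_reach E F s u W \<Longrightarrow> v \<notin> W \<Longrightarrow> (v, u) \<in> E \<inter> F
    \<Longrightarrow> residual_reach E F s v (insert v W)"

text \<open>A visited vertex is the end of an initial piece of the path. Hence an unreachable vertex
  never lies in \<open>W\<close>, and the freshness condition holds when a path is extended towards
  it.\<close>

lemma residual_reach_visited:
  "residual_reach E F s v W \<Longrightarrow> w \<in> W \<Longrightarrow> \<exists>W'. residual_reach E F s w W'"
proof (induction rule: residual_reach.induct)
  case start
  then show ?case by (auto intro: residual_reach.start)
next
  case (forward u W v)
  then show ?case using residual_reach.forward[of E F s u W v] by blast
next
  case (backward u W v)
  then show ?case using residual_reach.backward[of E F s u W v] by blast
qed

lemma residual_reach_vertex:
  "residual_reach E F s v W \<Longrightarrow> v \<in> insert s (fst ` E \<union> snd ` E)"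
  by (induction rule: residual_reach.induct) (auto simp: rev_image_eqI)

text \<open>Inserting forward edges and deleting backward ones pushes one unit along the path; each
  step moves the deficit from \<open>u\<close> on to \<open>v\<close>. The invariant that
  \<open>F'\<close> and \<open>F\<close> agree outside \<open>W \<times> W\<close> tells the status
  in \<open>F'\<close> of the next edge, which has its end \<open>v\<close> outside
  \<open>W\<close>.\<close>

lemma residual_reach_augment:
  assumes "residual_reach E F s v W" "finite E" "F \<subseteq> E"
  shows "v \<in> W \<and> (\<exists>F'\<subseteq>E. F' - W \<times> W = F - W \<times> W \<and>
    (\<forall>x. excess E (\<lambda>e. of_bool (e \<in> F')) x =
      excess E (\<lambda>e. of_bool (e \<in> F)) x + of_bool (s = x) - of_bool (v = x)))"
  using assms(1)
proof (induction rule: residual_reach.induct)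
  case start
  show ?case using \<open>F \<subseteq> E\<close> by auto
next
  case (forward u W v)
  then obtain F' where F': "F' \<subseteq> E" "F' - W \<times> W = F - W \<times> W"
    "\<And>x. excess E (\<lambda>e. of_bool (e \<in> F')) x =
      excess E (\<lambda>e. of_bool (e \<in> F)) x + of_bool (s = x) - of_bool (u = x)" by blast
  have new: "(u, v) \<notin> F'" using F'(2) forward.hyps by blast
  let ?F = "insert (u, v) F'"
  have "excess E (\<lambda>e. of_bool (e \<in> ?F)) x =
      excess E (\<lambda>e. of_bool (e \<in> F)) x + of_bool (s = x) - of_bool (v = x)" for x
  proof -
    have "excess E (\<lambda>e. of_bool (e \<in> ?F)) x
        = excess E (\<lambda>e. of_bool (e \<in> F') + of_bool (e = (u, v))) x"
      by (rule excess_cong) (use new in auto)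
    also have "\<dots> = excess E (\<lambda>e. of_bool (e \<in> F)) x + of_bool (s = x) - of_bool (v = x)"
      using forward.hyps \<open>finite E\<close> by (simp add: excess_add excess_single F'(3))
    finally show ?thesis .
  qed
  \<comment> \<open>The changed edge lies in the enlarged square because the induction hypothesis
    also gives \<open>u\<close> in \<open>W\<close>.\<close>
  moreover have "?F - insert v W \<times> insert v W = F - insert v W \<times> insert v W"
    using F'(2) forward.IH by blast
  moreover have "?F \<subseteq> E" using F'(1) forward.hyps by blast
  ultimately show ?case by blast
next
  case (backward u W v)
  then obtain F' where F': "F' \<subseteq> E" "F' - W \<times> W = F - W \<times> W"
    "\<And>x. excess E (\<lambda>e. of_bool (e \<in> F')) x =
      excess E (\<lambda>e. of_bool (e \<in> F)) x + of_bool (s = x) - of_bool (u = x)" by blast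
  have old: "(v, u) \<in> F'" using F'(2) backward.hyps by blast
  let ?F = "F' - {(v, u)}"
  have "excess E (\<lambda>e. of_bool (e \<in> ?F)) x =
      excess E (\<lambda>e. of_bool (e \<in> F)) x + of_bool (s = x) - of_bool (v = x)" for x
  proof -
    have "excess E (\<lambda>e. of_bool (e \<in> ?F)) x
        = excess E (\<lambda>e. of_bool (e \<in> F') - of_bool (e = (v, u))) x"
      by (rule excess_cong) (use old in auto)
    also have "\<dots> = excess E (\<lambda>e. of_bool (e \<in> F)) x + of_bool (s = x) - of_bool (v = x)"
      using backward.hyps \<open>finite E\<close> by (simp add: excess_diff excess_single F'(3))
    finally show ?thesis .
  qed
  moreover have "?F - insert v W \<times> insert v W = F - insert v W \<times> insert v W"
    using F'(2) backward.IH by blast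
  moreover have "?F \<subseteq> E" using F'(1) by blast
  ultimately show ?case by blast
qed

text \<open>Max-flow min-cut with integrality. Among the finitely many edge sets whose indicator is
  conserved, one of largest value has no augmenting path; the set reachable in its residual graph is
  then a cut whose bound it attains, and that bound holds for real-valued flows too.\<close>

lemma unit_capacity_max_flow_integral:
  fixes E :: "('v \<times> 'v) set"
  assumes "finite E" "s \<noteq> t"
  obtains F where "F \<subseteq> E" "\<And>v. v \<noteq> s \<Longrightarrow> v \<noteq> t \<Longrightarrow> excess E (\<lambda>e. of_bool (e \<in> F)) v = 0"
    "\<And>g. (\<And>e. e \<in> E \<Longrightarrow> 0 \<le> g e \<and> g e \<le> 1) \<Longrightarrow>
      (\<And>v. v \<noteq> s \<Longrightarrow> v \<noteq> t \<Longrightarrow> excess E g v = 0) \<Longrightarrow>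
      excess E g s \<le> excess E (\<lambda>e. of_bool (e \<in> F)) s"
proof -
  let ?x = "\<lambda>F. excess E (\<lambda>e. of_bool (e \<in> F))"
  define A where "A = {F \<in> Pow E. \<forall>v. v \<noteq> s \<longrightarrow> v \<noteq> t \<longrightarrow> ?x F v = 0}"
  have "finite A" using \<open>finite E\<close> by (simp add: A_def)
  moreover have "{} \<in> A" by (simp add: A_def excess_def)
  ultimately have "Max ((\<lambda>F. ?x F s) ` A) \<in> (\<lambda>F. ?x F s) ` A" by (intro Max_in) auto
  then obtain F where FA: "F \<in> A" and Fmax: "?x F s = Max ((\<lambda>F. ?x F s) ` A)" by auto
  have F: "F \<in> A" "\<And>G. G \<in> A \<Longrightarrow> ?x G s \<le> ?x F s"
    using FA \<open>finite A\<close> by (auto simp: Fmax)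
  have FE: "F \<subseteq> E" using F(1) by (simp add: A_def)
  have F0: "?x F v = 0" if "v \<noteq> s" "v \<noteq> t" for v using F(1) that by (simp add: A_def)
  \<comment> \<open>The source side of the cut.\<close>
  define R where "R = {v. \<exists>W. residual_reach E F s v W}"
  have sR: "s \<in> R" by (auto simp: R_def intro: residual_reach.start)
  have tR: "t \<notin> R"
  proof
    assume "t \<in> R"
    then obtain W where "residual_reach E F s t W" by (auto simp: R_def)
    from residual_reach_augment[OF this \<open>finite E\<close> FE] obtain F' where F': "F' \<subseteq> E"
      "\<And>x. ?x F' x = ?x F x + of_bool (s = x) - of_bool (t = x)" by blast
    then have "F' \<in> A" using F0 by (simp add: A_def)
    \<comment> \<open>Since \<open>s\<close> and \<open>t\<close> differ, augmentation raises the
      excess at \<open>s\<close> by exactly one.\<close>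
    from F(2)[OF this] show False using F'(2)[of s] \<open>s \<noteq> t\<close> by simp
  qed
  have "R \<subseteq> insert s (fst ` E \<union> snd ` E)"
    using residual_reach_vertex unfolding R_def by fast
  then have "finite R" by (rule finite_subset) (use \<open>finite E\<close> in simp)
  \<comment> \<open>Edges leaving \<open>R\<close> are saturated: otherwise a forward step would
    reach their head. Dually, \<open>inn\<close> shows that edges entering \<open>R\<close> carry
    nothing.\<close>
  have out: "e \<in> F" if e: "e \<in> E" "fst e \<in> R" "snd e \<notin> R" for e
  proof (rule ccontr)
    assume "e \<notin> F"
    obtain W where W: "residual_reach E F s (fst e) W" using e(2) unfolding R_def by blast
    have "snd e \<notin> W"
      using e(3) residual_reach_visited[OF W] unfolding R_def by blast
    with W have "residual_reach E F s (snd e) (insert (snd e) W)"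
      using e(1) \<open>e \<notin> F\<close> by (intro residual_reach.forward) auto
    then show False using e(3) unfolding R_def by blast
  qed
  have inn: "e \<notin> F" if e: "e \<in> E" "fst e \<notin> R" "snd e \<in> R" for e
  proof
    assume "e \<in> F"
    obtain W where W: "residual_reach E F s (snd e) W" using e(3) unfolding R_def by blast
    have "fst e \<notin> W"
      using e(2) residual_reach_visited[OF W] unfolding R_def by blast
    with W have "residual_reach E F s (fst e) (insert (fst e) W)"
      using e(1) \<open>e \<in> F\<close> by (intro residual_reach.backward) auto
    then show False using e(2) unfolding R_def by blast
  qed
  \<comment> \<open>Summing over \<open>R\<close> leaves only the term of \<open>s\<close>, since
    \<open>t\<close> lies outside \<open>R\<close> and all other excesses vanish.\<close>
  have cut: "excess E g s = (\<Sum>e\<in>E. g e * (of_bool (fst e \<in> R) - of_bool (snd e \<in> R)))"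
    if "\<And>v. v \<noteq> s \<Longrightarrow> v \<noteq> t \<Longrightarrow> excess E g v = 0" for g
  proof -
    have "(\<Sum>v\<in>R. excess E g v) = (\<Sum>v\<in>{s}. excess E g v)"
      by (rule sum.mono_neutral_right) (use \<open>finite R\<close> sR tR that in auto)
    then show ?thesis using sum_excess[OF \<open>finite R\<close>, of E g] by simp
  qed
  show ?thesis
  proof (rule that[OF FE F0])
    fix g assume g: "\<And>e. e \<in> E \<Longrightarrow> 0 \<le> g e \<and> g e \<le> 1"
      and g0: "\<And>v. v \<noteq> s \<Longrightarrow> v \<noteq> t \<Longrightarrow> excess E g v = 0"
    have "(\<Sum>e\<in>E. g e * (of_bool (fst e \<in> R) - of_bool (snd e \<in> R)))
        \<le> (\<Sum>e\<in>E. of_bool (e \<in> F) * (of_bool (fst e \<in> R) - of_bool (snd e \<in> R)))"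
    \<comment> \<open>The coefficient is 1 on edges leaving \<open>R\<close>, where the indicator of
      \<open>F\<close> is 1; it is -1 on edges entering \<open>R\<close>, where the indicator is 0;
      elsewhere it is 0.\<close>
    proof (rule sum_mono)
      fix e assume "e \<in> E"
      then show "g e * (of_bool (fst e \<in> R) - of_bool (snd e \<in> R))
          \<le> of_bool (e \<in> F) * (of_bool (fst e \<in> R) - of_bool (snd e \<in> R))"
        using g[of e] out[of e] inn[of e] by (auto simp: of_bool_def)
    qed
    then show "excess E g s \<le> ?x F s"
      using cut[of g, OF g0] cut[of "\<lambda>e. of_bool (e \<in> F)", OF F0] by simp
  qed auto
qed

section \<open>Maximal chains as paths in the Hasse diagram\<close>

text \<open>Covering is taken in the whole order, so that these are edges of the network.
  Cover-disjointness of a family says that these edge sets are pairwise disjoint.\<close>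

definition chain_edges :: "'a rel \<Rightarrow> 'a set \<Rightarrow> ('a \<times> 'a) set" where
  "chain_edges r C = {(x, y). x \<in> C \<and> y \<in> C \<and> covers r y x}"

text \<open>Order duality: together with the next two lemmas, it turns results about upper
  neighbours and \<open>t\<close> into results about lower neighbours and \<open>s\<close>.\<close>

lemma covers_converse: "covers (r\<inverse>) x y \<longleftrightarrow> covers r y x"
  by (auto simp: covers_def)

lemma Chains_converse: "Chains (r\<inverse>) = Chains r"
  unfolding Chains_def by blast

lemma maximal_chain_converse: "maximal_chain P (r\<inverse>) C \<longleftrightarrow> maximal_chain P r C"
  by (simp add: maximal_chain_def Chains_converse)

text \<open>The greatest element is comparable to everything, so adjoining it keeps a chain a
  chain.\<close>

lemma maximal_chain_top:
  assumes "maximal_chain P r C" "t \<in> P" "\<forall>x\<in>P. (x, t) \<in> r"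
  shows "t \<in> C"
proof -
  have "C \<subseteq> P" "C \<in> Chains r" using assms(1) by (auto simp: maximal_chain_def)
  then have "insert t C \<in> Chains r" using assms(2,3) unfolding Chains_def by blast
  then show ?thesis using assms(1,2) unfolding maximal_chain_def by blast
qed

lemma wf_strict_partial_order:
  assumes "finite P" "partial_order_on P r"
  shows "wf (r - Id)"
proof (rule finite_acyclic_wf)
  have "r \<subseteq> P \<times> P"
    using assms(2) by (auto simp: partial_order_on_def preorder_on_def)
  then show "finite (r - Id)"
    using \<open>finite P\<close> by (meson finite_Diff finite_SigmaI finite_subset)
  have "trans (r - Id)"
    using assms(2) by (auto simp: partial_order_on_def preorder_on_def intro: trans_diff_Id)
  then show "acyclic (r - Id)" by (simp add: acyclic_def)
qed

text \<open>The cover is the least element of \<open>C\<close> strictly above \<open>x\<close>. An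
  element strictly between the two would be comparable to all of \<open>C\<close>, hence could be
  adjoined. Two covers of \<open>x\<close> in \<open>C\<close> are comparable, hence equal.\<close>

lemma maximal_chain_ex1_cover:
  assumes "finite P" "partial_order_on P r" "maximal_chain P r C"
    and t: "t \<in> P" "\<forall>x\<in>P. (x, t) \<in> r" and x: "x \<in> C" "x \<noteq> t"
  shows "\<exists>!y. y \<in> C \<and> covers r y x"
proof -
  have anti: "a = b" if "(a, b) \<in> r" "(b, a) \<in> r" for a b
    using assms(2) that by (auto simp: partial_order_on_def antisym_def)
  have trans: "(a, c) \<in> r" if "(a, b) \<in> r" "(b, c) \<in> r" for a b c
    using assms(2) that unfolding partial_order_on_def preorder_on_def by (blast dest: transD)
  have sub: "r \<subseteq> P \<times> P"
    using assms(2) by (auto simp: partial_order_on_def preorder_on_def refl_on_def)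
  have comp: "(a, b) \<in> r \<or> (b, a) \<in> r" if "a \<in> C" "b \<in> C" for a b
    using assms(3) that by (auto simp: maximal_chain_def Chains_def)
  have CP: "C \<subseteq> P" using assms(3) by (simp add: maximal_chain_def)
  define U where "U = {y \<in> C. (x, y) \<in> r \<and> x \<noteq> y}"
  have "t \<in> U" using maximal_chain_top[OF assms(3) t] x t CP by (auto simp: U_def)
  obtain y where "y \<in> U" and y_min: "\<And>z. (z, y) \<in> r - Id \<Longrightarrow> z \<notin> U"
    using wfE_min[OF wf_strict_partial_order[OF assms(1,2)] \<open>t \<in> U\<close>] by metis
  \<comment> \<open>In a chain a minimal element is least.\<close>
  have y: "y \<in> U" "\<And>z. z \<in> U \<Longrightarrow> (y, z) \<in> r"
    using \<open>y \<in> U\<close> y_min comp by (auto simp: U_def)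
  have "covers r y x"
    unfolding covers_def
  proof (intro conjI notI)
    show "(x, y) \<in> r" using y(1) by (simp add: U_def)
    show False if "x = y" using y(1) that by (simp add: U_def)
    assume "\<exists>z. (x, z) \<in> r \<and> x \<noteq> z \<and> (z, y) \<in> r \<and> z \<noteq> y"
    then obtain z where z: "(x, z) \<in> r" "x \<noteq> z" "(z, y) \<in> r" "z \<noteq> y" by blast
    then have "z \<in> P" using sub by blast
    have "z \<notin> C" using y(2)[of z] z anti by (auto simp: U_def)
    \<comment> \<open>Each \<open>c\<close> in the chain is either at most \<open>x\<close>, thus
      below \<open>z\<close>, or in \<open>U\<close>, thus at least \<open>y\<close> and above
      \<open>z\<close>.\<close>
    have "(z, c) \<in> r \<or> (c, z) \<in> r" if "c \<in> C" for c
    proof (cases "(c, x) \<in> r")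
      case True
      then show ?thesis using z trans by blast
    next
      case False
      then have "c \<in> U" using comp[of c x] comp[of c c] that x by (auto simp: U_def)
      then show ?thesis using y(2) z trans by blast
    qed
    moreover have "(z, z) \<in> r"
      using \<open>z \<in> P\<close> assms(2) by (auto simp: partial_order_on_def preorder_on_def refl_on_def)
    ultimately have "insert z C \<in> Chains r" using comp by (auto simp: Chains_def)
    then show False using assms(3) \<open>z \<in> P\<close> \<open>z \<notin> C\<close> by (auto simp: maximal_chain_def)
  qed
  moreover have "y \<in> C" using y(1) by (simp add: U_def)
  moreover have "y' = y" if "y' \<in> C" "covers r y' x" for y'
    using that calculation comp[of y y'] by (auto simp: covers_def)
  ultimately show ?thesis by blast
qed

section \<open>Chains and unit flows in a finite bounded poset\<close>

locale finite_bounded_poset =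
  fixes P :: "'a set" and r :: "'a rel" and s t :: 'a
  assumes finite_carrier: "finite P"
    and partial_order: "partial_order_on P r"
    and bot: "s \<in> P" "\<forall>x\<in>P. (s, x) \<in> r"
    and top: "t \<in> P" "\<forall>x\<in>P. (x, t) \<in> r"
    and bot_neq_top: "s \<noteq> t"
begin

definition hasse :: "('a \<times> 'a) set" where
  "hasse = {(x, y) \<in> P \<times> P. covers r y x}"

lemma finite_hasse: "finite hasse"
  by (rule finite_subset[of _ "P \<times> P"]) (auto simp: hasse_def finite_carrier)

lemma order_refl: "x \<in> P \<Longrightarrow> (x, x) \<in> r"
  using partial_order by (auto simp: partial_order_on_def preorder_on_def refl_on_def)

lemma order_antisym: "(x, y) \<in> r \<Longrightarrow> (y, x) \<in> r \<Longrightarrow> x = y"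
  using partial_order by (auto simp: partial_order_on_def antisym_def)

lemma order_trans: "(x, y) \<in> r \<Longrightarrow> (y, z) \<in> r \<Longrightarrow> (x, z) \<in> r"
  using partial_order unfolding partial_order_on_def preorder_on_def by (blast dest: transD)

lemma order_carrier: "(x, y) \<in> r \<Longrightarrow> x \<in> P \<and> y \<in> P"
  using partial_order by (auto simp: partial_order_on_def preorder_on_def)

lemma not_covers_bot: "\<not> covers r s x"
  using bot order_carrier order_antisym unfolding covers_def by blast

lemma not_top_covered: "\<not> covers r x t"
  using top order_carrier order_antisym unfolding covers_def by blast

lemma chain_edges_subset_hasse: "C \<subseteq> P \<Longrightarrow> chain_edges r C \<subseteq> hasse"
  by (auto simp: chain_edges_def hasse_def)

text \<open>Each member of \<open>C\<close> except \<open>t\<close> has one outgoing edge within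
  \<open>C\<close>, and each except \<open>s\<close> one incoming edge. The degrees cancel away from
  the two ends, so the indicator is a unit flow from \<open>s\<close> to \<open>t\<close>.\<close>

lemma excess_maximal_chain:
  assumes C: "maximal_chain P r C"
  shows "excess hasse (\<lambda>e. of_bool (e \<in> chain_edges r C)) v = of_bool (v = s) - of_bool (v = t)"
proof -
  have tC: "t \<in> C" by (rule maximal_chain_top[OF C top])
  \<comment> \<open>In the converse order \<open>s\<close> is the greatest element; this yields
    membership of \<open>s\<close> and unique lower neighbours.\<close>
  have C': "maximal_chain P (r\<inverse>) C" using C by (simp add: maximal_chain_converse)
  have po': "partial_order_on P (r\<inverse>)" using partial_order by simp
  have bot': "\<forall>x\<in>P. (x, s) \<in> r\<inverse>" using bot by simp
  have sC: "s \<in> C" by (rule maximal_chain_top[OF C' bot(1) bot'])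
  have card1: "card {x. Q x} = 1" if Q: "\<exists>!x. Q x" for Q :: "'a \<Rightarrow> bool"
  proof -
    obtain y where "Q y" "\<And>x. Q x \<Longrightarrow> x = y" using Q by blast
    then have "{x. Q x} = {y}" by blast
    then show ?thesis by simp
  qed
  have out: "card {x. (v, x) \<in> chain_edges r C} = of_bool (v \<in> C \<and> v \<noteq> t)"
  proof (cases "v \<in> C \<and> v \<noteq> t")
    case True
    then have "card {x. x \<in> C \<and> covers r x v} = 1"
      using maximal_chain_ex1_cover[OF finite_carrier partial_order C top] by (intro card1) blast
    then show ?thesis using True by (simp add: chain_edges_def)
  next
    case False
    then have "{x. (v, x) \<in> chain_edges r C} = {}"
      using not_top_covered by (auto simp: chain_edges_def)
    then show ?thesis using False by auto
  qed
  have into: "card {x. (x, v) \<in> chain_edges r C} = of_bool (v \<in> C \<and> v \<noteq> s)"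
  proof (cases "v \<in> C \<and> v \<noteq> s")
    case True
    then have "card {x. x \<in> C \<and> covers r v x} = 1"
      using maximal_chain_ex1_cover[OF finite_carrier po' C' bot(1) bot', of v]
      by (intro card1) (simp add: covers_converse)
    then show ?thesis using True by (simp add: chain_edges_def)
  next
    case False
    then have "{x. (x, v) \<in> chain_edges r C} = {}"
      using not_covers_bot by (auto simp: chain_edges_def)
    then show ?thesis using False by auto
  qed
  have "C \<subseteq> P" using C by (simp add: maximal_chain_def)
  then show ?thesis
    using excess_of_bool[OF finite_hasse chain_edges_subset_hasse] out into sC tC bot_neq_top
    by auto
qed

text \<open>Edges of \<open>F\<close> are followed upwards until \<open>t\<close>. The last conjunct
  is maximality among the elements above \<open>v\<close>; for \<open>v = s\<close> this is
  maximality in \<open>P\<close>.\<close>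

lemma path_to_top_is_chain:
  assumes F: "F \<subseteq> hasse"
    and continue: "\<And>u v. (u, v) \<in> F \<Longrightarrow> v \<noteq> t \<Longrightarrow> \<exists>w. (v, w) \<in> F"
    and v: "v = t \<or> (\<exists>w. (v, w) \<in> F)"
  shows "\<exists>C \<subseteq> {x. (v, x) \<in> r}. v \<in> C \<and> C \<in> Chains r \<and> chain_edges r C \<subseteq> F \<and>
    (\<forall>z. (v, z) \<in> r \<longrightarrow> insert z C \<in> Chains r \<longrightarrow> z \<in> C)"
proof -
  \<comment> \<open>The induction descends from \<open>t\<close>: the hypothesis is available for
    all elements strictly above \<open>v\<close>.\<close>
  have "wf (r\<inverse> - Id)"
    using wf_strict_partial_order[of P "r\<inverse>"] finite_carrier partial_order by simp
  then show ?thesis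
    using v
  proof (induction v rule: wf_induct_rule)
    case (less v)
    show ?case
    proof (cases "v = t")
      case True
      have "z = t" if "(t, z) \<in> r" for z
        using that top order_carrier order_antisym by blast
      then show ?thesis
        using True top order_refl
        by (intro exI[of _ "{t}"]) (auto simp: Chains_def chain_edges_def covers_def)
    next
      case False
      then obtain w where w: "(v, w) \<in> F" using less.prems by blast
      then have cov: "covers r w v" using F by (auto simp: hasse_def)
      then have vw: "(v, w) \<in> r" "v \<noteq> w" by (auto simp: covers_def)
      then have "(w, v) \<in> r\<inverse> - Id" by auto
      then obtain C where C: "C \<subseteq> {x. (w, x) \<in> r}" "w \<in> C" "C \<in> Chains r"
        "chain_edges r C \<subseteq> F" "\<And>z. (w, z) \<in> r \<Longrightarrow> insert z C \<in> Chains r \<Longrightarrow> z \<in> C"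
        using less.IH[of w] continue[OF w] by blast
      have vC: "(v, c) \<in> r" if "c \<in> C" for c using that C(1) vw order_trans by blast
      have vv: "(v, v) \<in> r" using vw order_carrier order_refl by blast
      have "insert v C \<in> Chains r"
        using C(3) vC vv unfolding Chains_def by blast
      moreover have "chain_edges r (insert v C) \<subseteq> F"
      proof (clarify)
        fix x y assume "(x, y) \<in> chain_edges r (insert v C)"
        then have xy: "x \<in> insert v C" "y \<in> insert v C" "covers r y x"
          by (auto simp: chain_edges_def)
        \<comment> \<open>No member of the new chain lies strictly below \<open>v\<close>, which
          rules out the first case. In the second, \<open>w\<close> lies between \<open>v\<close>
          and \<open>y\<close>, so \<open>y = w\<close>, and the edge is the chosen one.\<close>
        consider "y = v" | "x = v" "y \<in> C" | "x \<in> C" "y \<in> C" using xy by blast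
        then show "(x, y) \<in> F"
        proof cases
          case 1
          then have "x = v"
            using xy vC order_antisym unfolding covers_def by blast
          with 1 xy show ?thesis by (simp add: covers_def)
        next
          case 2
          then have "(w, y) \<in> r" using C(1) by blast
          then have "y = w" using 2 xy vw unfolding covers_def by blast
          with 2 w show ?thesis by simp
        next
          case 3
          then show ?thesis using xy C(4) by (auto simp: chain_edges_def)
        qed
      qed
      moreover have "z \<in> insert v C" if z: "(v, z) \<in> r" "insert z (insert v C) \<in> Chains r" for z
      proof -
        have zC: "insert z C \<in> Chains r" using z(2) by (auto simp: Chains_def)
        \<comment> \<open>Above \<open>w\<close> the maximality of \<open>C\<close> applies; between
          \<open>v\<close> and \<open>w\<close> the covering relation leaves only the two
          ends.\<close>
        have "(w, z) \<in> r \<or> (z, w) \<in> r" using zC C(2) by (auto simp: Chains_def)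
        then show ?thesis
        proof
          assume "(w, z) \<in> r"
          then show ?thesis using C(5) zC by blast
        next
          assume "(z, w) \<in> r"
          then have "z = v \<or> z = w" using z(1) cov unfolding covers_def by blast
          then show ?thesis using C(2) by blast
        qed
      qed
      ultimately show ?thesis
        using vC vv by (intro exI[of _ "insert v C"]) blast
    qed
  qed
qed

text \<open>Removing the edges of one maximal chain inside \<open>F\<close> lowers the value by one
  and keeps conservation. Recording that each chain uses only edges of \<open>F\<close> makes the
  chains from the remainder share no edge with the removed one.\<close>

lemma flow_decomposition:
  assumes "F \<subseteq> hasse" "excess hasse (\<lambda>e. of_bool (e \<in> F)) s = real k"
    "\<And>v. v \<noteq> s \<Longrightarrow> v \<noteq> t \<Longrightarrow> excess hasse (\<lambda>e. of_bool (e \<in> F)) v = 0"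
  shows "\<exists>S. finite S \<and> card S = k \<and> cover_disjoint r S \<and>
    (\<forall>C\<in>S. maximal_chain P r C \<and> chain_edges r C \<subseteq> F)"
  using assms
proof (induction k arbitrary: F)
  case 0
  then show ?case by (intro exI[of _ "{}"]) (simp add: cover_disjoint_def)
next
  case (Suc k)
  note ex = excess_of_bool[OF finite_hasse \<open>F \<subseteq> hasse\<close>]
  have "{w. (s, w) \<in> F} \<noteq> {}"
  proof
    assume "{w. (s, w) \<in> F} = {}"
    then have "excess hasse (\<lambda>e. of_bool (e \<in> F)) s \<le> 0" by (simp add: ex del: Collect_empty_eq)
    then show False using Suc.prems(2) by simp
  qed
  \<comment> \<open>An edge into \<open>v\<close> forces an edge out of it by conservation;
    \<open>v\<close> is not \<open>s\<close> because \<open>s\<close> covers nothing.\<close>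
  moreover have "\<exists>w. (v, w) \<in> F" if uv: "(u, v) \<in> F" "v \<noteq> t" for u v
  proof -
    have "v \<noteq> s" using uv Suc.prems(1) not_covers_bot by (auto simp: hasse_def)
    then have eq: "card {x. (v, x) \<in> F} = card {x. (x, v) \<in> F}"
      using Suc.prems(3)[of v] uv ex by simp
    have "finite F" by (rule finite_subset[OF Suc.prems(1) finite_hasse])
    have "finite {x. (x, v) \<in> F}"
      by (rule finite_subset[of _ "fst ` F"]) (use \<open>finite F\<close> in force)+
    then have "card {x. (x, v) \<in> F} > 0" using uv by (auto simp: card_gt_0_iff)
    with eq have "{x. (v, x) \<in> F} \<noteq> {}" by (metis card.empty less_irrefl)
    then show ?thesis by blast
  qed
  ultimately obtain C where C: "C \<subseteq> {x. (s, x) \<in> r}" "s \<in> C" "C \<in> Chains r"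
    "chain_edges r C \<subseteq> F" "\<And>z. (s, z) \<in> r \<Longrightarrow> insert z C \<in> Chains r \<Longrightarrow> z \<in> C"
    using path_to_top_is_chain[OF \<open>F \<subseteq> hasse\<close>, of s] by blast
  have max: "maximal_chain P r C"
    using C bot order_carrier unfolding maximal_chain_def by blast
  let ?F = "F - chain_edges r C"
  have ex': "excess hasse (\<lambda>e. of_bool (e \<in> ?F)) v =
      excess hasse (\<lambda>e. of_bool (e \<in> F)) v - (of_bool (v = s) - of_bool (v = t))" for v
  proof -
    have "excess hasse (\<lambda>e. of_bool (e \<in> ?F)) v
        = excess hasse (\<lambda>e. of_bool (e \<in> F) - of_bool (e \<in> chain_edges r C)) v"
      by (rule excess_cong) (use C(4) in auto)
    then show ?thesis by (simp add: excess_diff excess_maximal_chain[OF max])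
  qed
  have "\<exists>S. finite S \<and> card S = k \<and> cover_disjoint r S \<and>
      (\<forall>D\<in>S. maximal_chain P r D \<and> chain_edges r D \<subseteq> ?F)"
    using Suc.prems bot_neq_top by (intro Suc.IH) (auto simp: ex' simp del: Diff_iff)
  then obtain S where S: "finite S" "card S = k" "cover_disjoint r S"
    "\<And>D. D \<in> S \<Longrightarrow> maximal_chain P r D \<and> chain_edges r D \<subseteq> ?F" by blast
  \<comment> \<open>A member of \<open>S\<close> avoids all edges of \<open>C\<close>, so
    \<open>C\<close> could belong to \<open>S\<close> only if it had no edges. This makes the
    cardinality grow by one.\<close>
  have "chain_edges r C \<noteq> {}"
  proof
    assume "chain_edges r C = {}"
    then show False
      using excess_maximal_chain[OF max, of s] bot_neq_top by (simp add: excess_def)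
  qed
  then have "C \<notin> S" using S(4) by blast
  moreover have "cover_disjoint r (insert C S)"
    unfolding cover_disjoint_def
  proof (intro allI impI ballI)
    fix x y D D'
    assume xy: "covers r y x" and D: "D \<in> insert C S" "D' \<in> insert C S"
      "{x, y} \<subseteq> D \<and> {x, y} \<subseteq> D'"
    then have mem: "(x, y) \<in> chain_edges r D" "(x, y) \<in> chain_edges r D'"
      by (auto simp: chain_edges_def)
    show "D = D'"
    proof (cases "D \<in> S \<and> D' \<in> S")
      case True
      then show ?thesis using S(3) xy D(3) unfolding cover_disjoint_def by blast
    next
      case False
      then show ?thesis using mem D(1,2) S(4) by blast
    qed
  qed
  ultimately show ?case
    using S C(4) max by (intro exI[of _ "insert C S"]) auto
qed

text \<open>The indicators of the chains are superposed. Cover-disjointness lets at most one chain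
  use an edge, which gives the capacity bound; conservation and value follow by linearity.\<close>

lemma chains_to_flow:
  assumes S: "\<forall>C\<in>S. maximal_chain P r C" "cover_disjoint r S"
  obtains g where "\<And>e. e \<in> hasse \<Longrightarrow> 0 \<le> g e \<and> g e \<le> 1"
    "\<And>v. v \<noteq> s \<Longrightarrow> v \<noteq> t \<Longrightarrow> excess hasse g v = 0" "excess hasse g s = real (card S)"
proof
  let ?g = "\<lambda>e. \<Sum>C\<in>S. of_bool (e \<in> chain_edges r C) :: real"
  have "S \<subseteq> Pow P" using S(1) by (auto simp: maximal_chain_def)
  then have "finite S" using finite_carrier finite_subset by blast
  show "0 \<le> ?g e \<and> ?g e \<le> 1" for e
  proof -
    obtain x y where e: "e = (x, y)" by (cases e)
    have "C = D" if "C \<in> S" "D \<in> S" "e \<in> chain_edges r C" "e \<in> chain_edges r D" for C D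
    proof -
      have "covers r y x" "{x, y} \<subseteq> C \<and> {x, y} \<subseteq> D"
        using that by (auto simp: chain_edges_def e)
      then show ?thesis using S(2) that(1,2) unfolding cover_disjoint_def by blast
    qed
    then have "card (S \<inter> {C. e \<in> chain_edges r C}) \<le> 1"
      using \<open>finite S\<close> by (intro card_le_Suc0_iff_eq[THEN iffD2, simplified One_nat_def[symmetric]]) auto
    then show ?thesis using \<open>finite S\<close> by (simp add: sum_of_bool_eq)
  qed
  have ex: "excess hasse ?g v = real (card S) * (of_bool (v = s) - of_bool (v = t))" for v
    using S(1) by (simp add: excess_sum excess_maximal_chain)
  show "excess hasse ?g v = 0" if "v \<noteq> s" "v \<noteq> t" for v using that by (simp add: ex)
  show "excess hasse ?g s = real (card S)" using bot_neq_top by (simp add: ex)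
qed

section \<open>Flows of the poset network in terms of excess\<close>

lemma poset_network_sel:
  "verts (poset_network P r s t) = P" "edges (poset_network P r s t) = hasse"
  "source (poset_network P r s t) = s" "sink (poset_network P r s t) = t"
  "capacity (poset_network P r s t) = (\<lambda>_. 1)"
  by (simp_all add: poset_network_def hasse_def)

text \<open>Vertices outside \<open>P\<close> meet no edge and have excess zero, so conservation can
  be demanded at every value of the type.\<close>

lemma flow_poset_network_iff:
  "flow (poset_network P r s t) f \<longleftrightarrow>
    (\<forall>e\<in>hasse. 0 \<le> f e \<and> f e \<le> 1) \<and> (\<forall>v. v \<noteq> s \<longrightarrow> v \<noteq> t \<longrightarrow> excess hasse f v = 0)"
proof -
  have "excess hasse f v = 0" if "v \<notin> P" for v
    unfolding excess_def by (rule sum.neutral) (use that in \<open>auto simp: hasse_def\<close>)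
  then show ?thesis
    unfolding flow_def poset_network_sel by (auto simp: excess_altdef[OF finite_hasse])
qed

lemma net_flow_poset_network: "net_flow (poset_network P r s t) f = excess hasse f s"
  unfolding net_flow_def poset_network_sel excess_altdef[OF finite_hasse] ..

end

section \<open>Equality of the largest chain family and the maximum flow value\<close>

theorem lemma4p5:
  fixes P :: "'a set" and r :: "'a rel" and s t :: 'a
  assumes "finite P" and "partial_order_on P r"
    and "s \<in> P" and "\<forall>x\<in>P. (s, x) \<in> r"
    and "t \<in> P" and "\<forall>x\<in>P. (x, t) \<in> r"
    and "s \<noteq> t"
  shows "(\<exists>f. maximum_flow (poset_network P r s t) f) \<and>
    (\<forall>f. maximum_flow (poset_network P r s t) f \<longrightarrow>
       real (Max (card ` {S. (\<forall>C\<in>S. maximal_chain P r C) \<and> cover_disjoint r S})) =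
         net_flow (poset_network P r s t) f)"
proof -
  interpret finite_bounded_poset P r s t by unfold_locales (use assms in auto)
  let ?N = "poset_network P r s t"
  let ?K = "{S. (\<forall>C\<in>S. maximal_chain P r C) \<and> cover_disjoint r S}"
  obtain F where F: "F \<subseteq> hasse"
    "\<And>v. v \<noteq> s \<Longrightarrow> v \<noteq> t \<Longrightarrow> excess hasse (\<lambda>e. of_bool (e \<in> F)) v = 0"
    "\<And>g. (\<And>e. e \<in> hasse \<Longrightarrow> 0 \<le> g e \<and> g e \<le> 1) \<Longrightarrow>
      (\<And>v. v \<noteq> s \<Longrightarrow> v \<noteq> t \<Longrightarrow> excess hasse g v = 0) \<Longrightarrow>
      excess hasse g s \<le> excess hasse (\<lambda>e. of_bool (e \<in> F)) s"
    using unit_capacity_max_flow_integral[OF finite_hasse \<open>s \<noteq> t\<close>] by blast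
  let ?f = "\<lambda>e. of_bool (e \<in> F) :: real"
  have max: "maximum_flow ?N ?f"
    unfolding maximum_flow_def flow_poset_network_iff net_flow_poset_network
    using F by auto
  \<comment> \<open>With no edge into \<open>s\<close>, the value of \<open>F\<close> is a natural
    number, as the decomposition into chains requires.\<close>
  have "{x. (x, s) \<in> F} = {}" using F(1) not_covers_bot by (auto simp: hasse_def)
  then have val: "excess hasse ?f s = real (card {x. (s, x) \<in> F})"
    by (simp add: excess_of_bool[OF finite_hasse F(1)] del: Collect_empty_eq)
  have "Max (card ` ?K) = card {x. (s, x) \<in> F}"
  \<comment> \<open>Superposition turns any admissible family into a flow, which \<open>F\<close>
    bounds; decomposing \<open>F\<close> gives a family attaining the bound.\<close>
  proof (rule Max_eqI)
    have "?K \<subseteq> Pow (Pow P)" by (auto simp: maximal_chain_def)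
    then have "finite ?K" using \<open>finite P\<close> by (meson finite_Pow_iff finite_subset)
    then show "finite (card ` ?K)" by simp
    show "n \<le> card {x. (s, x) \<in> F}" if n: "n \<in> card ` ?K" for n
    proof -
      obtain S where S: "n = card S" "\<forall>C\<in>S. maximal_chain P r C" "cover_disjoint r S"
        using n by auto
      obtain g where "\<And>e. e \<in> hasse \<Longrightarrow> 0 \<le> g e \<and> g e \<le> 1"
        "\<And>v. v \<noteq> s \<Longrightarrow> v \<noteq> t \<Longrightarrow> excess hasse g v = 0" "excess hasse g s = real (card S)"
        using chains_to_flow[OF S(2,3)] by blast
      then have "real (card S) \<le> excess hasse ?f s" using F(3)[of g] by simp
      then show ?thesis using val S(1) by simp
    qed
    show "card {x. (s, x) \<in> F} \<in> card ` ?K"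
      using flow_decomposition[OF F(1) val F(2)] by (auto simp: image_iff)
  qed
  \<comment> \<open>Any two maximum flows have the same value, so the result for \<open>F\<close>
    carries over to all of them.\<close>
  moreover have "net_flow ?N f = net_flow ?N ?f" if "maximum_flow ?N f" for f
    using that max unfolding maximum_flow_def by (meson antisym)
  ultimately show ?thesis using max val by (auto simp: net_flow_poset_network)
qed

end
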